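(* Let $T$ be the quantized tensor representation of $f$ on $\mathcal{D}_K$, where the depth $K$ is an arbitrary positive integer and $f:[0,1]\to\mathbb{R}$ is the restriction of an $\Omega$-bandlimited function ($\Omega>0$) with spectral measure $\mu$. Then for any $\varepsilon>0$, the $(\varepsilon,\infty)$ ranks of all unfolding matrices of $T$ are bounded uniformly by $$\sqrt{\Omega}+O\left(1+\log_+\left(\frac{|\mu|}{\varepsilon}\right)\right);$$ that is, there is an absolute constant $C$ (independent of $K,m,f,\Omega,\mu,\varepsilon$) such that $r_m^{(\varepsilon,\infty)}[T]\le\sqrt{\Omega}+C\left(1+\log_+(|\mu|/\varepsilon)\right)$ for all $m=1,\dots,K-1$.
   Context: A function $f:\mathbb{R}\to\mathbb{R}$ is $\Omega$-bandlimited ($\Omega>0$) if $f(x)=\frac{1}{2\pi}\int e^{i\omega x}\,d\mu(\omega)$ for a signed measure $\mu$ supported on $[-\Omega,\Omega]$ with total variation $|\mu|<\infty$; $\mu$ is called the spectral measure of $f$. Here $|\mu|$ denotes the total variation (a number), and $\log_+(x)=\max\{\log x,0\}$ with $\log_+(0)=0$. Dyadic grid: $\mathcal{D}_K=(2^{-K}\mathbb{Z})\cap[0,1)$; each $x\in\mathcal{D}_K$ is written uniquely as $x=\sum_{k=1}^K 2^{-k}\sigma_k$ with $\sigma_k\in\{0,1\}$. The quantized tensor representation of $f:[0,1]\to\mathbb{R}$ on $\mathcal{D}_K$ is the tensor $T:\{0,1\}^K\to\mathbb{R}$, $T(\sigma_1,\dots,\sigma_K)=f\left(\sum_{k=1}^K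 2^{-k}\sigma_k\right)$. Tensor norm: $\|S\|_\infty=\max_{\sigma\in\{0,1\}^K}|S(\sigma)|$. The $(\varepsilon,\infty)$ rank of the $m$-th unfolding matrix, denoted $r_m^{(\varepsilon,\infty)}[T]$, is the smallest $r$ such that $\left\|T-\sum_{\alpha=0}^{r-1}T_L^\alpha\otimes T_R^\alpha\right\|_\infty\le\varepsilon$ for some tensors $T_L^\alpha:\{0,1\}^m\to\mathbb{R}$ and $T_R^\alpha:\{0,1\}^{K-m}\to\mathbb{R}$, where $(T_L\otimes T_R)(\sigma_1,\dots,\sigma_K)=T_L(\sigma_1,\dots,\sigma_m)\,T_R(\sigma_{m+1},\dots,\sigma_K)$. *)

theory Defs
  imports "HOL-Analysis.Analysis"
begin

text \<open>
  Finite signed measures are represented as real-valued, countably additive set functions on the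
  measurable sets of a measure space \<^term>\<open>M\<close>; only \<^term>\<open>space M\<close> and \<^term>\<open>sets M\<close> matter.
\<close>

definition signed_measure :: "'a measure \<Rightarrow> ('a set \<Rightarrow> real) \<Rightarrow> bool" where
  "signed_measure M \<nu> \<longleftrightarrow>
     \<nu> {} = 0 \<and>
     (\<forall>A :: nat \<Rightarrow> 'a set. range A \<subseteq> sets M \<longrightarrow> disjoint_family A \<longrightarrow>
        (\<lambda>i. \<nu> (A i)) sums \<nu> (\<Union>i. A i))"

definition total_variation :: "'a measure \<Rightarrow> ('a set \<Rightarrow> real) \<Rightarrow> ennreal" where
  "total_variation M \<nu> =
     (SUP P \<in> {P. finite P \<and> P \<subseteq> sets M \<and> partition_on (space M) P}.
        \<Sum>A\<in>P. ennreal \<bar>\<nu> A\<bar>)"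

text \<open>
  The positive part of the Jordan decomposition of \<^term>\<open>\<nu>\<close>; the negative part is the positive part
  of \<^term>\<open>-\<nu>\<close>. As \<^term>\<open>ennreal\<close> truncates negative reals to 0 and \<^term>\<open>\<nu> {} = 0\<close>, the supremum is
  the usual upper variation. Lemmas \<open>emeasure_pos_part\<close> and \<open>jordan_decomposition\<close> below
  confirm that these parts are the intended finite measures.
\<close>

definition pos_part :: "'a measure \<Rightarrow> ('a set \<Rightarrow> real) \<Rightarrow> 'a measure" where
  "pos_part M \<nu> =
     measure_of (space M) (sets M) (\<lambda>A. SUP B \<in> {B \<in> sets M. B \<subseteq> A}. ennreal (\<nu> B))"

definition neg_part :: "'a measure \<Rightarrow> ('a set \<Rightarrow> real) \<Rightarrow> 'a measure" where
  "neg_part M \<nu> = pos_part M (\<lambda>A. - \<nu> A)"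

definition signed_integral ::
    "'a measure \<Rightarrow> ('a set \<Rightarrow> real) \<Rightarrow> ('a \<Rightarrow> 'b :: {banach, second_countable_topology}) \<Rightarrow> 'b" where
  "signed_integral M \<nu> g = integral\<^sup>L (pos_part M \<nu>) g - integral\<^sup>L (neg_part M \<nu>) g"

definition supported_on :: "'a measure \<Rightarrow> ('a set \<Rightarrow> real) \<Rightarrow> 'a set \<Rightarrow> bool" where
  "supported_on M \<nu> S \<longleftrightarrow> (\<forall>A \<in> sets M. A \<inter> S = {} \<longrightarrow> \<nu> A = 0)"

definition bandlimited :: "real \<Rightarrow> (real set \<Rightarrow> real) \<Rightarrow> (real \<Rightarrow> real) \<Rightarrow> bool" where
  "bandlimited \<Omega> \<mu> F \<longleftrightarrow>
     signed_measure borel \<mu> \<and>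
     total_variation borel \<mu> < \<infinity> \<and>
     supported_on borel \<mu> {-\<Omega>..\<Omega>} \<and>
     (\<forall>x. complex_of_real (F x) =
        1 / (2 * complex_of_real pi) *
        signed_integral borel \<mu> (\<lambda>\<omega>. exp (\<i> * complex_of_real \<omega> * complex_of_real x)))"

definition log_plus :: "real \<Rightarrow> real" where
  "log_plus x = (if x = 0 then 0 else max (ln x) 0)"

text \<open>
  A tensor \<open>{0,1}\<^sup>K \<rightarrow> \<real>\<close> is a function on Boolean lists of which only the values at lists of
  length \<open>K\<close> matter; \<open>\<sigma>\<^sub>k\<close> is the entry of the list at position \<open>k - 1\<close>.
\<close>

definition quantized_tensor :: "nat \<Rightarrow> (real \<Rightarrow> real) \<Rightarrow> bool list \<Rightarrow> real" where
  "quantized_tensor K f \<sigma> = f (\<Sum>k=1..K. (1/2) ^ k * of_bool (\<sigma> ! (k - 1)))"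

definition tensor_norm :: "nat \<Rightarrow> (bool list \<Rightarrow> real) \<Rightarrow> real" where
  "tensor_norm K S = Max ((\<lambda>\<sigma>. \<bar>S \<sigma>\<bar>) ` {\<sigma>. length \<sigma> = K})"

definition tensor_prod :: "nat \<Rightarrow> (bool list \<Rightarrow> real) \<Rightarrow> (bool list \<Rightarrow> real) \<Rightarrow> bool list \<Rightarrow> real" where
  "tensor_prod m TL TR \<sigma> = TL (take m \<sigma>) * TR (drop m \<sigma>)"

definition eps_rank :: "nat \<Rightarrow> nat \<Rightarrow> real \<Rightarrow> (bool list \<Rightarrow> real) \<Rightarrow> nat" where
  "eps_rank K m \<epsilon> T =
     (LEAST r. \<exists>(TL :: nat \<Rightarrow> bool list \<Rightarrow> real) (TR :: nat \<Rightarrow> bool list \<Rightarrow> real).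
        tensor_norm K (\<lambda>\<sigma>. T \<sigma> - (\<Sum>\<alpha><r. tensor_prod m (TL \<alpha>) (TR \<alpha>) \<sigma>)) \<le> \<epsilon>)"

lemma space_pos_part [simp]: "space (pos_part M \<nu>) = space M"
  and sets_pos_part [simp]: "sets (pos_part M \<nu>) = sets M"
  by (simp_all add: pos_part_def)

lemma signed_measure_Un:
  assumes "signed_measure M \<nu>" "A \<in> sets M" "B \<in> sets M" "A \<inter> B = {}"
  shows "\<nu> (A \<union> B) = \<nu> A + \<nu> B"
proof -
  have "range (binaryset A B) \<subseteq> sets M"
    using assms by (auto simp: range_binaryset_eq)
  moreover have "disjoint_family (binaryset A B)"
    using assms(4) by (auto simp: disjoint_family_on_def binaryset_def)
  ultimately have 1: "(\<lambda>i. \<nu> (binaryset A B i)) sums \<nu> (A \<union> B)"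
    using assms(1) unfolding signed_measure_def by (metis UN_binaryset_eq)
  have "\<nu> {} = 0" using assms(1) by (simp add: signed_measure_def)
  then have "(\<lambda>i. \<nu> (binaryset A B i)) sums (\<nu> A + \<nu> B)"
    by (rule binaryset_sums)
  with 1 show ?thesis by (simp add: sums_iff)
qed

lemma signed_measure_uminus:
  "signed_measure M \<nu> \<Longrightarrow> signed_measure M (\<lambda>A. - \<nu> A)"
  by (auto simp: signed_measure_def intro: sums_minus)

lemma emeasure_pos_part:
  assumes \<nu>: "signed_measure M \<nu>" and A: "A \<in> sets M"
  shows "emeasure (pos_part M \<nu>) A = (SUP B \<in> {B \<in> sets M. B \<subseteq> A}. ennreal (\<nu> B))"
proof -
  define p where "p = (\<lambda>A. SUP B \<in> {B \<in> sets M. B \<subseteq> A}. ennreal (\<nu> B))"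
  have \<nu>0: "\<nu> {} = 0" using \<nu> by (simp add: signed_measure_def)
  have upper: "ennreal (\<nu> B) \<le> p X" if "B \<in> sets M" "B \<subseteq> X" for B X
    unfolding p_def using that by (intro SUP_upper) auto
  have least: "p X \<le> c" if "\<And>B. B \<in> sets M \<Longrightarrow> B \<subseteq> X \<Longrightarrow> ennreal (\<nu> B) \<le> c" for X c
    unfolding p_def using that by (intro SUP_least) auto
  have mono: "p X \<le> p Y" if "X \<subseteq> Y" for X Y
    by (rule least, rule upper) (use that in auto)
  have ne: "{B \<in> sets M. B \<subseteq> Z} \<noteq> {}" for Z by auto
  have super: "p X + p Y \<le> p (X \<union> Y)" if "X \<inter> Y = {}" for X Y
  proof -
    have *: "ennreal (\<nu> B) + ennreal (\<nu> C) \<le> p (X \<union> Y)"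
      if B: "B \<in> sets M" "B \<subseteq> X" and C: "C \<in> sets M" "C \<subseteq> Y" for B C
    proof -
      define B' where "B' = (if \<nu> B \<ge> 0 then B else {})"
      define C' where "C' = (if \<nu> C \<ge> 0 then C else {})"
      have "ennreal (\<nu> B) + ennreal (\<nu> C) = ennreal (\<nu> B' + \<nu> C')"
        by (auto simp: B'_def C'_def \<nu>0 ennreal_neg)
      also have "\<nu> B' + \<nu> C' = \<nu> (B' \<union> C')"
        using B C \<open>X \<inter> Y = {}\<close>
        by (intro signed_measure_Un[OF \<nu>, symmetric]) (auto simp: B'_def C'_def)
      also have "ennreal \<dots> \<le> p (X \<union> Y)"
        using B C by (intro upper) (auto simp: B'_def C'_def)
      finally show ?thesis .
    qed
    have "ennreal (\<nu> C) + p X \<le> p (X \<union> Y)" if "C \<in> sets M" "C \<subseteq> Y" for C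
      unfolding p_def[THEN fun_cong, of X] ennreal_SUP_add_right[OF ne]
      using * that by (intro SUP_least) (auto simp: add.commute)
    then show ?thesis
      unfolding p_def[THEN fun_cong, of Y] ennreal_SUP_add_right[OF ne]
      by (intro SUP_least) (auto simp: add.commute)
  qed
  have "countably_additive (sets M) p"
  proof (rule countably_additiveI)
    fix F :: "nat \<Rightarrow> 'a set"
    assume F: "range F \<subseteq> sets M" "disjoint_family F"
    show "(\<Sum>i. p (F i)) = p (\<Union>i. F i)"
    proof (rule antisym)
      have fin: "(\<Sum>i<n. p (F i)) \<le> p (\<Union>i<n. F i)" for n
      proof (induction n)
        case (Suc n)
        have "(\<Sum>i<Suc n. p (F i)) \<le> p (\<Union>i<n. F i) + p (F n)"
          using Suc by (simp add: add_mono)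
        also have "\<dots> \<le> p ((\<Union>i<n. F i) \<union> F n)"
        proof (rule super)
          have "F i \<inter> F n = {}" if "i < n" for i
            using F(2) that by (intro disjoint_family_onD) auto
          then show "(\<Union>i<n. F i) \<inter> F n = {}" by blast
        qed
        finally show ?case by (simp add: lessThan_Suc Un_commute)
      qed simp
      show "(\<Sum>i. p (F i)) \<le> p (\<Union>i. F i)"
        by (rule suminf_le_const[OF summableI], rule order_trans[OF fin mono]) auto
      show "p (\<Union>i. F i) \<le> (\<Sum>i. p (F i))"
      proof (rule least)
        fix B assume B: "B \<in> sets M" "B \<subseteq> (\<Union>i. F i)"
        have "range (\<lambda>i. B \<inter> F i) \<subseteq> sets M" "disjoint_family (\<lambda>i. B \<inter> F i)"
          using B F(1) disjoint_family_subset[OF F(2), of "\<lambda>i. B \<inter> F i"] by auto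
        then have "(\<lambda>i. \<nu> (B \<inter> F i)) sums \<nu> (\<Union>i. B \<inter> F i)"
          using \<nu> unfolding signed_measure_def by blast
        moreover have "(\<Union>i. B \<inter> F i) = B" using B by auto
        ultimately have "(\<lambda>n. \<Sum>i<n. \<nu> (B \<inter> F i)) \<longlonglongrightarrow> \<nu> B"
          by (simp add: sums_def)
        then have lim: "(\<lambda>n. ennreal (\<Sum>i<n. \<nu> (B \<inter> F i))) \<longlonglongrightarrow> ennreal (\<nu> B)"
          by (rule tendsto_ennrealI)
        show "ennreal (\<nu> B) \<le> (\<Sum>i. p (F i))"
        proof (rule LIMSEQ_le_const2[OF lim], intro exI allI impI)
          fix n :: nat
          have "ennreal (\<Sum>i<n. \<nu> (B \<inter> F i)) \<le> ennreal (\<Sum>i<n. max 0 (\<nu> (B \<inter> F i)))"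
            by (intro ennreal_leI sum_mono) auto
          also have "\<dots> = (\<Sum>i<n. ennreal (max 0 (\<nu> (B \<inter> F i))))"
            by (rule sum_ennreal[symmetric]) auto
          also have "\<dots> \<le> (\<Sum>i<n. p (F i))"
          proof (rule sum_mono)
            fix i
            have "ennreal (\<nu> (B \<inter> F i)) \<le> p (F i)"
              using B F by (intro upper) auto
            then show "ennreal (max 0 (\<nu> (B \<inter> F i))) \<le> p (F i)"
              by (simp add: max_def ennreal_neg)
          qed
          also have "\<dots> \<le> (\<Sum>i. p (F i))"
            by (intro sum_le_suminf) auto
          finally show "ennreal (\<Sum>i<n. \<nu> (B \<inter> F i)) \<le> (\<Sum>i. p (F i))" .
        qed
      qed
    qed
  qed
  moreover have "positive (sets M) p"
    using least[of "{}" 0] by (simp add: positive_def \<nu>0)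
  moreover have "pos_part M \<nu> = measure_of (space M) (sets M) p"
    unfolding pos_part_def p_def ..
  ultimately have "emeasure (pos_part M \<nu>) A = p A"
    using A by (simp add: emeasure_measure_of_sigma sets.sigma_algebra_axioms)
  then show ?thesis by (simp add: p_def)
qed

lemma emeasure_neg_part:
  assumes "signed_measure M \<nu>" "A \<in> sets M"
  shows "emeasure (neg_part M \<nu>) A = (SUP B \<in> {B \<in> sets M. B \<subseteq> A}. ennreal (- \<nu> B))"
  using emeasure_pos_part[OF signed_measure_uminus[OF assms(1)] assms(2)] unfolding neg_part_def .

lemma total_variation_conv_parts:
  assumes \<nu>: "signed_measure M \<nu>"
  shows "total_variation M \<nu> =
    emeasure (pos_part M \<nu>) (space M) + emeasure (neg_part M \<nu>) (space M)"
proof (rule antisym)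
  let ?p = "emeasure (pos_part M \<nu>)" and ?n = "emeasure (neg_part M \<nu>)"
  have \<nu>0: "\<nu> {} = 0" using \<nu> by (simp add: signed_measure_def)
  show "total_variation M \<nu> \<le> ?p (space M) + ?n (space M)"
    unfolding total_variation_def
  proof (rule SUP_least)
    fix P assume "P \<in> {P. finite P \<and> P \<subseteq> sets M \<and> partition_on (space M) P}"
    then have P: "finite P" "P \<subseteq> sets M" "\<Union>P = space M" "disjoint P"
      by (auto simp: partition_on_def)
    have 1: "(\<Sum>A\<in>P. ennreal \<bar>\<nu> A\<bar>) \<le> (\<Sum>A\<in>P. ?p A + ?n A)"
    proof (rule sum_mono)
      fix A assume "A \<in> P"
      then have A: "A \<in> sets M" using P by auto
      have "ennreal (\<nu> A) \<le> ?p A"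
        unfolding emeasure_pos_part[OF \<nu> A] using A by (intro SUP_upper) simp
      moreover have "ennreal (- \<nu> A) \<le> ?n A"
        unfolding emeasure_neg_part[OF \<nu> A] using A by (intro SUP_upper) simp
      ultimately have "ennreal (\<nu> A) + ennreal (- \<nu> A) \<le> ?p A + ?n A"
        by (rule add_mono)
      moreover have "ennreal \<bar>\<nu> A\<bar> = ennreal (\<nu> A) + ennreal (- \<nu> A)"
        by (cases "\<nu> A \<ge> 0") (auto simp: ennreal_neg)
      ultimately show "ennreal \<bar>\<nu> A\<bar> \<le> ?p A + ?n A" by simp
    qed
    have "disjoint_family_on (\<lambda>A. A) P"
      using P(4) by (auto simp: disjoint_family_on_def disjoint_def)
    then have 2: "(\<Sum>A\<in>P. emeasure N A) = emeasure N (space M)" if "sets N = sets M" for N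
      using sum_emeasure[of "\<lambda>A. A" P N] P that by simp
    show "(\<Sum>A\<in>P. ennreal \<bar>\<nu> A\<bar>) \<le> ?p (space M) + ?n (space M)"
      using 1 2[of "pos_part M \<nu>"] 2[of "neg_part M \<nu>"] by (simp add: sum.distrib neg_part_def)
  qed
  have *: "ennreal (\<nu> B) + ennreal (- \<nu> C) \<le> total_variation M \<nu>"
    if BC0: "B \<in> sets M" "C \<in> sets M" for B C
  proof -
    define B' where "B' = (if \<nu> B \<ge> 0 then B else {})"
    define C' where "C' = (if \<nu> C \<le> 0 then C else {})"
    have BC: "B' \<in> sets M" "C' \<in> sets M" using BC0 by (auto simp: B'_def C'_def)
    define P where "P = {B' - C', C' - B', space M - ((B' - C') \<union> (C' - B'))} - {{}}"
    have P: "finite P" "P \<subseteq> sets M" "partition_on (space M) P"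
    proof -
      have "B' \<subseteq> space M" "C' \<subseteq> space M" using BC by (auto dest: sets.sets_into_space)
      moreover have "\<Union>P = (B' - C') \<union> (C' - B') \<union> (space M - ((B' - C') \<union> (C' - B')))"
        unfolding P_def by blast
      ultimately have "\<Union>P = space M" by blast
      moreover have "disjoint {B' - C', C' - B', space M - ((B' - C') \<union> (C' - B'))}"
        unfolding disjoint_def by blast
      then have "disjoint P"
        unfolding P_def by (rule pairwise_subset) auto
      ultimately show "partition_on (space M) P"
        by (simp add: partition_on_def P_def)
    qed (use BC in \<open>auto simp: P_def\<close>)
    have split: "\<nu> X = \<nu> (X - Y) + \<nu> (X \<inter> Y)" if "X \<in> sets M" "Y \<in> sets M" for X Y
      using signed_measure_Un[OF \<nu>, of "X - Y" "X \<inter> Y"] that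
      by (metis Diff_disjoint Int_Diff Int_commute Un_Diff_Int inf_bot_right sets.Diff sets.Int)
    have "\<nu> B' = \<nu> (B' - C') + \<nu> (B' \<inter> C')" "\<nu> C' = \<nu> (C' - B') + \<nu> (B' \<inter> C')"
      using split[of B' C'] split[of C' B'] BC by (simp_all add: Int_commute)
    then have 1: "\<nu> B' - \<nu> C' \<le> \<bar>\<nu> (B' - C')\<bar> + \<bar>\<nu> (C' - B')\<bar>" by linarith
    have 2: "\<bar>\<nu> (B' - C')\<bar> + \<bar>\<nu> (C' - B')\<bar> = (\<Sum>A\<in>{B' - C', C' - B'} - {{}}. \<bar>\<nu> A\<bar>)"
    proof (cases "B' - C' = C' - B'")
      case True
      then have "B' - C' = {}" "C' - B' = {}" by auto
      then show ?thesis by (simp add: \<nu>0)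
    next
      case False
      then show ?thesis
        by (subst sum.mono_neutral_left[of "{B' - C', C' - B'}"]) (auto simp: \<nu>0)
    qed
    have 3: "(\<Sum>A\<in>{B' - C', C' - B'} - {{}}. \<bar>\<nu> A\<bar>) \<le> (\<Sum>A\<in>P. \<bar>\<nu> A\<bar>)"
      using P(1) by (intro sum_mono2) (auto simp: P_def)
    have 4: "ennreal (\<nu> B' - \<nu> C') \<le> (\<Sum>A\<in>P. ennreal \<bar>\<nu> A\<bar>)"
      using 1 2 3 by (subst sum_ennreal) (auto intro: ennreal_leI)
    have 5: "(\<Sum>A\<in>P. ennreal \<bar>\<nu> A\<bar>) \<le> total_variation M \<nu>"
      unfolding total_variation_def using P by (intro SUP_upper) auto
    have 6: "ennreal (\<nu> B' - \<nu> C') = ennreal (\<nu> B) + ennreal (- \<nu> C)"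
      using ennreal_plus[of "\<nu> B" "- \<nu> C"]
      by (cases "\<nu> B \<ge> 0"; cases "\<nu> C \<le> 0") (simp_all add: B'_def C'_def \<nu>0 ennreal_neg)
    show ?thesis using order_trans[OF 4 5] unfolding 6 .
  qed
  have ne: "{B \<in> sets M. B \<subseteq> Z} \<noteq> {}" for Z by auto
  have "ennreal (- \<nu> C) + ?p (space M) \<le> total_variation M \<nu>" if "C \<in> sets M" for C
    unfolding emeasure_pos_part[OF \<nu> sets.top] ennreal_SUP_add_right[OF ne]
    using * that by (intro SUP_least) (auto simp: add.commute)
  then show "?p (space M) + ?n (space M) \<le> total_variation M \<nu>"
    unfolding emeasure_neg_part[OF \<nu> sets.top] ennreal_SUP_add_right[OF ne]
    by (intro SUP_least) (auto simp: add.commute)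
qed

lemma jordan_decomposition:
  assumes \<nu>: "signed_measure M \<nu>" and fin: "total_variation M \<nu> < \<infinity>" and A: "A \<in> sets M"
  shows "finite_measure (pos_part M \<nu>)" "finite_measure (neg_part M \<nu>)"
    and "\<nu> A = measure (pos_part M \<nu>) A - measure (neg_part M \<nu>) A"
proof -
  show p: "finite_measure (pos_part M \<nu>)" and n: "finite_measure (neg_part M \<nu>)"
    using fin unfolding total_variation_conv_parts[OF \<nu>]
    by (auto intro!: finite_measureI simp: neg_part_def less_top)
  have le: "measure (pos_part M \<mu>) A \<le> \<mu> A + measure (neg_part M \<mu>) A"
    if \<mu>: "signed_measure M \<mu>" and "finite_measure (pos_part M \<mu>)"
      and "finite_measure (neg_part M \<mu>)" for \<mu>
  proof -
    interpret p: finite_measure "pos_part M \<mu>" by fact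
    interpret n: finite_measure "neg_part M \<mu>" by fact
    have *: "\<mu> B \<le> \<mu> A + measure (neg_part M \<mu>) A" if B: "B \<in> sets M" "B \<subseteq> A" for B
    proof -
      have "ennreal (- \<mu> (A - B)) \<le> emeasure (neg_part M \<mu>) A"
        unfolding emeasure_neg_part[OF \<mu> A] using A B by (intro SUP_upper) auto
      then have "- \<mu> (A - B) \<le> measure (neg_part M \<mu>) A"
        by (simp add: n.emeasure_eq_measure ennreal_le_iff)
      moreover have "\<mu> A = \<mu> (A - B) + \<mu> B"
        using A B by (subst signed_measure_Un[OF \<mu>, symmetric]) (auto intro!: arg_cong[of _ _ \<mu>])
      ultimately show ?thesis by linarith
    qed
    have "0 \<le> \<mu> A + measure (neg_part M \<mu>) A"
      using *[of "{}"] \<mu> by (simp add: signed_measure_def)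
    moreover have "emeasure (pos_part M \<mu>) A \<le> ennreal (\<mu> A + measure (neg_part M \<mu>) A)"
      unfolding emeasure_pos_part[OF \<mu> A] using * by (intro SUP_least ennreal_leI) auto
    ultimately show ?thesis
      by (simp add: p.emeasure_eq_measure ennreal_le_iff)
  qed
  have swap: "neg_part M (\<lambda>A. - \<nu> A) = pos_part M \<nu>" "pos_part M (\<lambda>A. - \<nu> A) = neg_part M \<nu>"
    by (simp_all add: neg_part_def)
  from le[OF \<nu> p n] le[OF signed_measure_uminus[OF \<nu>]] p n
  show "\<nu> A = measure (pos_part M \<nu>) A - measure (neg_part M \<nu>) A"
    by (simp add: swap)
qed

end

theory Submission
  imports Defs "HOL-Computational_Algebra.Polynomial"
begin

text \<open>
  Write \<open>h = 2\<^sup>-\<^sup>m\<close>. The \<open>m\<close>-th unfolding of the tensor is the matrix \<open>F (x + y)\<close>, where \<open>x\<close> runs over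
  the \<open>2\<^sup>m\<close> multiples of \<open>h\<close> in \<open>[0, 1)\<close> and \<open>y\<close> over dyadic points of \<open>[0, h)\<close>. Two bounds on its
  approximate rank compete.

  The matrix has \<open>2\<^sup>m\<close> rows, so its rank is at most \<open>2\<^sup>m\<close> (\<open>eps_rank_le_power\<close>).

  Interpolating in \<open>y\<close> at \<open>n\<close> Chebyshev nodes of \<open>[0, h]\<close> replaces \<open>F (x + y)\<close> by a sum of \<open>n\<close> products
  of a function of \<open>x\<close> and a function of \<open>y\<close>. As \<open>F\<close> is a superposition of the functions
  \<open>cos (\<omega> x) / (2 \<pi>)\<close> with \<open>\<bar>\<omega>\<bar> \<le> \<Omega>\<close>, it suffices to interpolate a cosine, whose \<open>n\<close>-th derivative
  is at most \<open>\<Omega>\<^sup>n\<close>; the remainder formula of polynomial interpolation then bounds the error by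
  \<open>(\<Omega> h / 4)\<^sup>n / n! \<cdot> \<bar>\<mu>\<bar> / \<pi>\<close> (\<open>bandlimited_chebyshev_interpolation\<close>). Once \<open>n \<ge> \<Omega> h\<close>, the factor
  \<open>(\<Omega> h / 4)\<^sup>n / n!\<close> is at most \<open>(e / 4)\<^sup>n \<le> exp (- n / 4)\<close>. If moreover \<open>n \<ge> 4 log\<^sub>+ (\<bar>\<mu>\<bar> / \<epsilon>)\<close>, the
  error is at most \<open>\<epsilon>\<close> (\<open>eps_rank_bandlimited_le\<close>).

  Since \<open>2\<^sup>m \<cdot> \<Omega> h = \<Omega>\<close>, one of \<open>2\<^sup>m\<close> and \<open>\<Omega> h\<close> is at most \<open>sqrt \<Omega>\<close>, and the corresponding bound
  gives the claim with \<open>C = 4\<close>. That the coefficient of \<open>sqrt \<Omega>\<close> is exactly 1 relies on the constant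
  \<open>1/4\<close> inside the power, which comes from the Chebyshev nodes: with a Taylor expansion about the
  midpoint it would be \<open>1/2\<close>, and \<open>n\<close> would have to exceed \<open>(e/2) \<Omega> h > \<Omega> h\<close>.
\<close>

section \<open>Error of polynomial interpolation\<close>

text \<open>The sequence \<open>D\<close> lists a function and its successive derivatives.\<close>

lemma iterated_Rolle:
  fixes D :: "nat \<Rightarrow> real \<Rightarrow> real" and x :: "nat \<Rightarrow> real"
  assumes "\<And>k t. (D k has_real_derivative D (Suc k) t) (at t)"
    and "\<And>i. i < n \<Longrightarrow> x i < x (Suc i)" and "\<And>i. i \<le> n \<Longrightarrow> D 0 (x i) = 0"
  shows "\<exists>\<xi>. D n \<xi> = 0"
  using assms
proof (induction n arbitrary: D x)
  case 0
  then show ?case by blast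
next
  case (Suc n)
  have *: "\<exists>z. x i < z \<and> z < x (Suc i) \<and> D 1 z = 0" if "i \<le> n" for i
  proof -
    have "continuous_on {x i..x (Suc i)} (D 0)"
      using Suc.prems(1) by (meson DERIV_isCont continuous_at_imp_continuous_on)
    moreover have "(D 0 has_derivative (\<lambda>h. D 1 t * h)) (at t)" for t
      using Suc.prems(1)[of 0 t] by (simp add: has_field_derivative_def)
    moreover have "x i < x (Suc i)" "D 0 (x i) = D 0 (x (Suc i))"
      using Suc.prems(2)[of i] Suc.prems(3)[of i] Suc.prems(3)[of "Suc i"] that by simp_all
    ultimately obtain z where "x i < z" "z < x (Suc i)" "(\<lambda>h. D 1 z * h) = (\<lambda>h. 0)"
      using Rolle_deriv[of "x i" "x (Suc i)" "D 0" "\<lambda>t h. D 1 t * h"] by blast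
    then show ?thesis by (metis mult_1_right)
  qed
  obtain z where z: "\<And>i. i \<le> n \<Longrightarrow> x i < z i \<and> z i < x (Suc i) \<and> D 1 (z i) = 0"
    using * by metis
  have "\<exists>\<xi>. D (Suc n) \<xi> = 0"
  proof (rule Suc.IH[of "\<lambda>k. D (Suc k)" z])
    show "z i < z (Suc i)" if "i < n" for i
      using z[of i] z[of "Suc i"] that by force
  qed (use z Suc.prems(1) in auto)
  then show ?case .
qed

lemma poly_higher_pderiv_top:
  fixes q :: "real poly"
  assumes "degree q \<le> n"
  shows "poly ((pderiv ^^ n) q) t = fact n * coeff q n"
proof -
  have "degree ((pderiv ^^ n) q) = 0"
    using assms by (simp add: degree_higher_pderiv)
  then obtain c where "(pderiv ^^ n) q = [:c:]"
    by (meson degree_eq_zeroE)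
  moreover have "coeff ((pderiv ^^ n) q) 0 = fact n * coeff q n"
    by (simp add: coeff_higher_pderiv pochhammer_fact)
  ultimately show ?thesis by simp
qed

text \<open>
  The classical remainder estimate for a polynomial \<open>p\<close> that interpolates \<open>G 0\<close> at \<open>n\<close> nodes; \<open>G k\<close> is
  the \<open>k\<close>-th derivative. The node polynomial \<open>w\<close> need not be monic, so that a Chebyshev polynomial
  can be used without normalizing it or factoring it over its roots.
\<close>

lemma interpolation_error:
  fixes G :: "nat \<Rightarrow> real \<Rightarrow> real" and x :: "nat \<Rightarrow> real" and p w :: "real poly"
  assumes deriv: "\<And>k t. (G k has_real_derivative G (Suc k) t) (at t)"
    and bound: "\<And>t. \<bar>G n t\<bar> \<le> M"
    and inj: "inj_on x {..<n}"
    and w: "w \<noteq> 0" "degree w = n" "\<And>i. i < n \<Longrightarrow> poly w (x i) = 0"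
    and p: "degree p \<le> n" "coeff p n = 0" "\<And>i. i < n \<Longrightarrow> poly p (x i) = G 0 (x i)"
  shows "\<bar>G 0 t - poly p t\<bar> \<le> M / (fact n * \<bar>lead_coeff w\<bar>) * \<bar>poly w t\<bar>"
proof (cases "t \<in> x ` {..<n}")
  case True
  then show ?thesis using w(3) p(3) by auto
next
  case False
  have card: "card (insert t (x ` {..<n})) = Suc n"
    using False inj by (simp add: card_image)
  have wt: "poly w t \<noteq> 0"
  proof
    assume "poly w t = 0"
    then have "insert t (x ` {..<n}) \<subseteq> {s. poly w s = 0}" using w(3) by auto
    then have "Suc n \<le> card {s. poly w s = 0}"
      using card card_mono[OF poly_roots_finite[OF w(1)]] by metis
    also have "\<dots> \<le> n" using card_poly_roots_bound[OF w(1)] w(2) by simp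
    finally show False by simp
  qed
  \<comment> \<open>This \<open>c\<close> gives \<open>G 0 - p - c w\<close> one more zero, at \<open>t\<close>, besides the \<open>n\<close> nodes.\<close>
  define c where "c = (G 0 t - poly p t) / poly w t"
  define q where "q = p + smult c w"
  define D where "D = (\<lambda>k s. G k s - poly ((pderiv ^^ k) q) s)"
  define zs where "zs = sorted_list_of_set (insert t (x ` {..<n}))"
  have zs: "length zs = Suc n" "set zs = insert t (x ` {..<n})" "sorted_wrt (<) zs"
    unfolding zs_def using card
    by (simp_all del: sorted_list_of_set_insert_remove)
  have "\<exists>\<xi>. D n \<xi> = 0"
  proof (rule iterated_Rolle[of D n "\<lambda>i. zs ! i"])
    show "(D k has_real_derivative D (Suc k) s) (at s)" for k s
      unfolding D_def by (auto intro!: derivative_eq_intros deriv poly_DERIV)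
    show "zs ! i < zs ! Suc i" if "i < n" for i
      using zs that by (simp add: sorted_wrt_iff_nth_less)
    show "D 0 (zs ! i) = 0" if "i \<le> n" for i
    proof -
      have "zs ! i \<in> insert t (x ` {..<n})" using zs that by (metis less_Suc_eq_le nth_mem)
      then show ?thesis using w(3) p(3) wt by (auto simp: D_def q_def c_def)
    qed
  qed
  then obtain \<xi> where "D n \<xi> = 0" by blast
  moreover have "poly ((pderiv ^^ n) q) \<xi> = fact n * (c * lead_coeff w)"
    using p w by (subst poly_higher_pderiv_top) (auto simp: q_def degree_add_le)
  ultimately have "G n \<xi> = fact n * (c * lead_coeff w)" by (simp add: D_def)
  then have "fact n * (\<bar>c\<bar> * \<bar>lead_coeff w\<bar>) \<le> M"
    using bound[of \<xi>] by (simp add: abs_mult)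
  then have "\<bar>c\<bar> \<le> M / (fact n * \<bar>lead_coeff w\<bar>)"
    using w(1) by (simp add: field_simps)
  then have "\<bar>c\<bar> * \<bar>poly w t\<bar> \<le> M / (fact n * \<bar>lead_coeff w\<bar>) * \<bar>poly w t\<bar>"
    by (intro mult_right_mono) auto
  moreover have "G 0 t - poly p t = c * poly w t" using wt by (simp add: c_def)
  ultimately show ?thesis by (simp add: abs_mult)
qed

text \<open>The Lagrange basis polynomials for the nodes \<open>x 0, \<dots>, x (n - 1)\<close>.\<close>

definition lagrange_basis :: "(nat \<Rightarrow> real) \<Rightarrow> nat \<Rightarrow> nat \<Rightarrow> real poly" where
  "lagrange_basis x n k =
     (\<Prod>j\<in>{..<n} - {k}. smult (1 / (x k - x j)) [:- x j, 1:])"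

lemma degree_lagrange_basis:
  assumes "k < n"
  shows "degree (lagrange_basis x n k) < n"
proof -
  have "degree (lagrange_basis x n k) \<le> (\<Sum>j\<in>{..<n} - {k}. 1)"
    unfolding lagrange_basis_def
    by (rule order_trans[OF degree_prod_sum_le sum_mono]) auto
  also have "\<dots> < n" using assms by simp
  finally show ?thesis .
qed

lemma poly_lagrange_basis:
  assumes "inj_on x {..<n}" "k < n" "i < n"
  shows "poly (lagrange_basis x n k) (x i) = of_bool (k = i)"
proof (cases "k = i")
  case True
  have "poly (smult (1 / (x k - x j)) [:- x j, 1:]) (x k) = 1" if "j \<in> {..<n} - {k}" for j
  proof -
    have "x k - x j \<noteq> 0" using that assms by (auto dest: inj_onD)
    then show ?thesis by (simp add: diff_divide_distrib[symmetric])
  qed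
  then show ?thesis
    using True unfolding lagrange_basis_def poly_prod by (simp only: prod.neutral ball_simps) simp
next
  case False
  then have "i \<in> {..<n} - {k}" using assms by auto
  then show ?thesis using False
    by (auto simp: lagrange_basis_def poly_prod intro!: prod_zero)
qed

section \<open>Chebyshev polynomials and nodes\<close>

text \<open>The Chebyshev polynomials of the first kind, \<open>T\<^sub>n (cos \<theta>) = cos (n \<theta>)\<close>.\<close>

fun chebyshev :: "nat \<Rightarrow> real poly" where
  "chebyshev 0 = 1"
| "chebyshev (Suc 0) = [:0, 1:]"
| "chebyshev (Suc (Suc n)) = [:0, 2:] * chebyshev (Suc n) - chebyshev n"

lemma poly_chebyshev_cos: "poly (chebyshev n) (cos \<theta>) = cos (real n * \<theta>)"
proof (induction n rule: chebyshev.induct)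
  case (3 n)
  have "cos (real (Suc (Suc n)) * \<theta>) = cos (real (Suc n) * \<theta> + \<theta>)"
    and "cos (real n * \<theta>) = cos (real (Suc n) * \<theta> - \<theta>)"
    by (simp_all add: algebra_simps)
  then show ?case using 3 by (simp add: cos_add cos_diff)
qed simp_all

lemma abs_poly_chebyshev_le:
  assumes "\<bar>t\<bar> \<le> 1"
  shows "\<bar>poly (chebyshev n) t\<bar> \<le> 1"
  using assms poly_chebyshev_cos[of n "arccos t"] by (simp add: cos_arccos_abs)

lemma degree_coeff_chebyshev:
  "degree (chebyshev n) \<le> n \<and> coeff (chebyshev n) n = (if n = 0 then 1 else 2 ^ (n - 1))"
proof (induction n rule: chebyshev.induct)
  case (3 n)
  have "degree ([:0, 2:] * chebyshev (Suc n)) \<le> Suc (Suc n)"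
    using 3 by (intro order_trans[OF degree_mult_le]) auto
  then have "degree (chebyshev (Suc (Suc n))) \<le> Suc (Suc n)"
    using 3 by (auto intro!: degree_diff_le)
  moreover have "coeff (chebyshev n) (Suc (Suc n)) = 0"
    using 3 by (intro coeff_eq_0) auto
  ultimately show ?case using 3 by simp
qed simp_all

lemma lead_coeff_chebyshev:
  assumes "n > 0"
  shows "degree (chebyshev n) = n" "lead_coeff (chebyshev n) = 2 ^ (n - 1)"
proof -
  show "degree (chebyshev n) = n"
    using degree_coeff_chebyshev[of n] assms by (intro antisym le_degree) auto
  then show "lead_coeff (chebyshev n) = 2 ^ (n - 1)"
    using degree_coeff_chebyshev[of n] assms by simp
qed

text \<open>The roots of the \<open>n\<close>-th Chebyshev polynomial, in decreasing order for \<open>k < n\<close>.\<close>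

definition chebyshev_node :: "nat \<Rightarrow> nat \<Rightarrow> real" where
  "chebyshev_node n k = cos ((2 * real k + 1) / (2 * real n) * pi)"

lemma poly_chebyshev_node:
  assumes "k < n"
  shows "poly (chebyshev n) (chebyshev_node n k) = 0"
proof -
  have "real n * ((2 * real k + 1) / (2 * real n) * pi) = of_int (2 * int k + 1) * (pi / 2)"
    using assms by (simp add: field_simps)
  then show ?thesis
    unfolding chebyshev_node_def poly_chebyshev_cos cos_zero_iff_int
    by (intro exI[of _ "2 * int k + 1"]) simp
qed

lemma inj_on_chebyshev_node: "inj_on (chebyshev_node n) {..<n}"
proof (rule inj_onI)
  fix i j assume ij: "i \<in> {..<n}" "j \<in> {..<n}" "chebyshev_node n i = chebyshev_node n j"
  have range: "0 \<le> (2 * real k + 1) / (2 * real n) * pi" "(2 * real k + 1) / (2 * real n) * pi \<le> pi"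
    if "k \<in> {..<n}" for k
  proof -
    have "2 * real k + 1 \<le> 2 * real n" using that by simp
    then have "(2 * real k + 1) / (2 * real n) \<le> 1" using that by simp
    then show "(2 * real k + 1) / (2 * real n) * pi \<le> pi"
      using mult_right_mono[of "(2 * real k + 1) / (2 * real n)" 1 pi] by (simp del: times_divide_eq_left)
  qed auto
  have "(2 * real i + 1) / (2 * real n) * pi = (2 * real j + 1) / (2 * real n) * pi"
    by (rule cos_inj_pi[OF range[OF ij(1)] range[OF ij(2)] ij(3)[unfolded chebyshev_node_def]])
  then show "i = j" using ij(1,2) by simp
qed

text \<open>Interpolation of \<open>cos (a s + b)\<close> at the Chebyshev nodes of \<open>[-1, 1]\<close>.\<close>

lemma chebyshev_interpolation_cos:
  fixes a b s :: real
  assumes n: "n > 0" and s: "\<bar>s\<bar> \<le> 1"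
  shows "\<bar>cos (a * s + b) -
      (\<Sum>k<n. cos (a * chebyshev_node n k + b) * poly (lagrange_basis (chebyshev_node n) n k) s)\<bar>
    \<le> \<bar>a\<bar> ^ n / (fact n * 2 ^ (n - 1))"
proof -
  let ?x = "chebyshev_node n"
  \<comment> \<open>Each differentiation of the cosine is a shift of the phase by \<open>\<pi>/2\<close>.\<close>
  define G where "G = (\<lambda>k t. a ^ k * cos (a * t + b + real k * (pi / 2)))"
  define p where "p = (\<Sum>k<n. smult (cos (a * ?x k + b)) (lagrange_basis ?x n k))"
  have deg: "degree p < n"
    unfolding p_def using n
    by (intro degree_sum_less le_less_trans[OF degree_smult_le degree_lagrange_basis]) auto
  have "\<bar>G 0 s - poly p s\<bar>
      \<le> \<bar>a\<bar> ^ n / (fact n * \<bar>lead_coeff (chebyshev n)\<bar>) * \<bar>poly (chebyshev n) s\<bar>"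
  proof (rule interpolation_error[OF _ _ inj_on_chebyshev_node])
    fix k t
    have "cos (a * t + b + real (Suc k) * (pi / 2)) = - sin (a * t + b + real k * (pi / 2))"
      using cos_add[of "a * t + b + real k * (pi / 2)" "pi / 2"]
      by (simp add: algebra_simps add_divide_distrib)
    then have "G (Suc k) t = a ^ k * (- sin (a * t + b + real k * (pi / 2)) * a)"
      by (simp add: G_def)
    then show "(G k has_real_derivative G (Suc k) t) (at t)"
      unfolding G_def by (auto intro!: derivative_eq_intros)
  next
    show "\<bar>G n t\<bar> \<le> \<bar>a\<bar> ^ n" for t
      by (simp add: G_def abs_mult power_abs mult_left_le)
  next
    show "poly p (?x i) = G 0 (?x i)" if "i < n" for i
    proof -
      have "poly p (?x i) = (\<Sum>k<n. if k = i then cos (a * ?x i + b) else 0)"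
        using that unfolding p_def
        by (auto simp: poly_sum poly_lagrange_basis[OF inj_on_chebyshev_node] intro!: sum.cong)
      then show ?thesis using that by (simp add: G_def)
    qed
  qed (use deg n lead_coeff_chebyshev[OF n] poly_chebyshev_node in \<open>auto intro: coeff_eq_0\<close>)
  also have "\<dots> \<le> \<bar>a\<bar> ^ n / (fact n * \<bar>lead_coeff (chebyshev n)\<bar>)"
    using abs_poly_chebyshev_le[OF s] by (intro mult_left_le) auto
  finally show ?thesis
    using lead_coeff_chebyshev[OF n] by (simp add: G_def p_def poly_sum)
qed

section \<open>Approximation of bandlimited functions\<close>

lemma bandlimited_finite_parts:
  assumes "bandlimited \<Omega> \<mu> F"
  shows "finite_measure (pos_part borel \<mu>)" "finite_measure (neg_part borel \<mu>)"
  using assms jordan_decomposition[of borel \<mu> "{}"] unfolding bandlimited_def by auto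

lemma total_variation_eq_measure_parts:
  assumes "bandlimited \<Omega> \<mu> F"
  shows "enn2real (total_variation borel \<mu>) =
    measure (pos_part borel \<mu>) UNIV + measure (neg_part borel \<mu>) UNIV"
proof -
  interpret p: finite_measure "pos_part borel \<mu>" by (rule bandlimited_finite_parts[OF assms])
  interpret n: finite_measure "neg_part borel \<mu>" by (rule bandlimited_finite_parts[OF assms])
  have "signed_measure borel \<mu>" using assms by (simp add: bandlimited_def)
  then show ?thesis
    by (simp add: total_variation_conv_parts p.emeasure_eq_measure n.emeasure_eq_measure
        flip: ennreal_plus)
qed

lemma AE_pos_part_supported:
  assumes "signed_measure M \<nu>" "supported_on M \<nu> S" "S \<in> sets M"
  shows "AE x in pos_part M \<nu>. x \<in> S"
proof (rule AE_I)
  have "ennreal (\<nu> B) = 0" if "B \<in> sets M" "B \<subseteq> space M - S" for B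
    using assms that unfolding supported_on_def by (metis Diff_disjoint disjoint_iff ennreal_0 subsetD)
  then have "(SUP B \<in> {B \<in> sets M. B \<subseteq> space M - S}. ennreal (\<nu> B)) \<le> 0"
    by (intro SUP_least) auto
  then show "emeasure (pos_part M \<nu>) (space M - S) = 0"
    using assms by (subst emeasure_pos_part) auto
qed (use assms in auto)

lemma AE_parts_bandlimited:
  assumes "bandlimited \<Omega> \<mu> F"
  shows "AE \<omega> in pos_part borel \<mu>. \<bar>\<omega>\<bar> \<le> \<Omega>" "AE \<omega> in neg_part borel \<mu>. \<bar>\<omega>\<bar> \<le> \<Omega>"
proof -
  have \<mu>: "signed_measure borel \<mu>" "supported_on borel \<mu> {-\<Omega>..\<Omega>}"
    using assms by (simp_all add: bandlimited_def)
  then have "supported_on borel (\<lambda>A. - \<mu> A) {-\<Omega>..\<Omega>}"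
    by (simp add: supported_on_def)
  then have "AE \<omega> in neg_part borel \<mu>. \<omega> \<in> {-\<Omega>..\<Omega>}"
    unfolding neg_part_def
    by (intro AE_pos_part_supported signed_measure_uminus \<mu>(1)) simp_all
  then show "AE \<omega> in neg_part borel \<mu>. \<bar>\<omega>\<bar> \<le> \<Omega>"
    by eventually_elim auto
  have "AE \<omega> in pos_part borel \<mu>. \<omega> \<in> {-\<Omega>..\<Omega>}"
    by (intro AE_pos_part_supported \<mu>) simp_all
  then show "AE \<omega> in pos_part borel \<mu>. \<bar>\<omega>\<bar> \<le> \<Omega>"
    by eventually_elim auto
qed

lemma integrable_cos_finite_measure:
  assumes "finite_measure N" "sets N = sets borel"
  shows "integrable N (\<lambda>\<omega>::real. cos (\<omega> * x))"
proof -
  interpret finite_measure N by fact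
  have "(\<lambda>\<omega>::real. cos (\<omega> * x)) \<in> borel_measurable N"
    using assms(2) by (simp cong: measurable_cong_sets)
  then show ?thesis by (intro integrable_const_bound[of _ 1]) auto
qed

lemma Re_integral_exp_ii:
  assumes "finite_measure N" "sets N = sets borel"
  shows "Re (\<integral>\<omega>. exp (\<i> * complex_of_real \<omega> * complex_of_real x) \<partial>N) = (\<integral>\<omega>. cos (\<omega> * x) \<partial>N)"
proof -
  interpret finite_measure N by fact
  have eq: "exp (\<i> * complex_of_real \<omega> * complex_of_real x) = cis (\<omega> * x)" for \<omega>
    by (simp add: cis_conv_exp mult.assoc)
  have "(\<lambda>\<omega>. cis (\<omega> * x)) \<in> borel_measurable borel"
    by (intro borel_measurable_continuous_onI continuous_intros)
  then have "(\<lambda>\<omega>. cis (\<omega> * x)) \<in> borel_measurable N"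
    using assms(2) by (simp cong: measurable_cong_sets)
  then have "integrable N (\<lambda>\<omega>. cis (\<omega> * x))"
    by (intro integrable_const_bound[of _ 1]) auto
  then show ?thesis unfolding eq by (simp flip: integral_Re)
qed

text \<open>Taking real parts, \<open>F\<close> is a superposition of cosines alone because it is real-valued.\<close>

lemma bandlimited_cos_integral:
  assumes "bandlimited \<Omega> \<mu> F"
  shows "F x = ((\<integral>\<omega>. cos (\<omega> * x) \<partial>pos_part borel \<mu>) - (\<integral>\<omega>. cos (\<omega> * x) \<partial>neg_part borel \<mu>)) / (2 * pi)"
proof -
  let ?e = "\<lambda>\<omega>. exp (\<i> * complex_of_real \<omega> * complex_of_real x)"
  have "complex_of_real (F x) = 1 / (2 * complex_of_real pi) * signed_integral borel \<mu> ?e"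
    using assms by (simp add: bandlimited_def)
  also have "1 / (2 * complex_of_real pi) = complex_of_real (1 / (2 * pi))" by simp
  finally have "F x = Re (complex_of_real (1 / (2 * pi)) * signed_integral borel \<mu> ?e)"
    by (metis Re_complex_of_real)
  also have "\<dots> = 1 / (2 * pi) * Re (signed_integral borel \<mu> ?e)"
    by simp
  finally show ?thesis
    using bandlimited_finite_parts[OF assms]
    by (simp add: signed_integral_def Re_integral_exp_ii neg_part_def)
qed

lemma finite_measure_abs_integral_le:
  fixes g :: "'a \<Rightarrow> real"
  assumes "finite_measure N" "integrable N g" "AE x in N. \<bar>g x\<bar> \<le> B"
  shows "\<bar>integral\<^sup>L N g\<bar> \<le> B * measure N (space N)"
proof -
  interpret finite_measure N by fact
  have "\<bar>integral\<^sup>L N g\<bar> \<le> (\<integral>x. \<bar>g x\<bar> \<partial>N)"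
    by (rule integral_abs_bound)
  also have "\<dots> \<le> (\<integral>x. B \<partial>N)"
    using assms by (intro integral_mono_AE) auto
  finally show ?thesis by (simp add: mult.commute)
qed

text \<open>
  A quadrature-like formula that holds up to \<open>B\<close> for all cosines of frequency at most \<open>\<Omega>\<close> transfers
  to bandlimited functions by integrating over the spectral measure.
\<close>

lemma bandlimited_linear_combination_bound:
  assumes F: "bandlimited \<Omega> \<mu> F"
    and B: "\<And>\<omega>. \<bar>\<omega>\<bar> \<le> \<Omega> \<Longrightarrow> \<bar>cos (\<omega> * x) - (\<Sum>k<n. cos (\<omega> * u k) * c k)\<bar> \<le> B"
  shows "\<bar>F x - (\<Sum>k<n. F (u k) * c k)\<bar> \<le> B * enn2real (total_variation borel \<mu>) / (2 * pi)"
proof -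
  let ?P = "pos_part borel \<mu>" and ?N = "neg_part borel \<mu>"
  define E where "E = (\<lambda>\<omega>. cos (\<omega> * x) - (\<Sum>k<n. cos (\<omega> * u k) * c k))"
  note fin = bandlimited_finite_parts[OF F]
  have int: "integrable N E"
    and eq: "integral\<^sup>L N E = (\<integral>\<omega>. cos (\<omega> * x) \<partial>N) - (\<Sum>k<n. (\<integral>\<omega>. cos (\<omega> * u k) \<partial>N) * c k)"
    if "finite_measure N" "sets N = sets borel" for N
    using integrable_cos_finite_measure[OF that] unfolding E_def by simp_all
  have le: "\<bar>integral\<^sup>L N E\<bar> \<le> B * measure N UNIV"
    if "finite_measure N" "sets N = sets borel" "AE \<omega> in N. \<bar>\<omega>\<bar> \<le> \<Omega>" for N
  proof -
    have "AE \<omega> in N. \<bar>E \<omega>\<bar> \<le> B"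
      using that(3) by eventually_elim (use B in \<open>simp add: E_def\<close>)
    then show ?thesis
      using finite_measure_abs_integral_le[OF that(1) int[OF that(1,2)]] sets_eq_imp_space_eq[OF that(2)]
      by simp
  qed
  have sets: "sets ?P = sets borel" "sets ?N = sets borel" by (simp_all add: neg_part_def)
  have "F x - (\<Sum>k<n. F (u k) * c k) = (integral\<^sup>L ?P E - integral\<^sup>L ?N E) / (2 * pi)"
    unfolding eq[OF fin(1) sets(1)] eq[OF fin(2) sets(2)] bandlimited_cos_integral[OF F]
    by (simp add: diff_divide_distrib sum_divide_distrib left_diff_distrib sum_subtractf)
  also have "\<bar>\<dots>\<bar> \<le> (\<bar>integral\<^sup>L ?P E\<bar> + \<bar>integral\<^sup>L ?N E\<bar>) / (2 * pi)"
    by (simp add: divide_right_mono)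
  also have "\<dots> \<le> (B * measure ?P UNIV + B * measure ?N UNIV) / (2 * pi)"
    using le[OF fin(1) sets(1)] le[OF fin(2) sets(2)] AE_parts_bandlimited[OF F]
    by (intro divide_right_mono add_mono) auto
  finally show ?thesis
    unfolding total_variation_eq_measure_parts[OF F] by (simp add: distrib_left)
qed

text \<open>
  Interpolation of \<open>y \<mapsto> F (x + y)\<close> at the Chebyshev nodes moved from \<open>[-1, 1]\<close> to \<open>[0, h]\<close>. The
  length \<open>h\<close> contributes \<open>h/2\<close> to the base of the power and the leading coefficient \<open>2\<^sup>n\<^sup>-\<^sup>1\<close> of the
  Chebyshev polynomial another factor \<open>1/2\<close>.
\<close>

lemma bandlimited_chebyshev_interpolation:
  assumes F: "bandlimited \<Omega> \<mu> F" and n: "n > 0" and h: "h > 0" and y: "0 \<le> y" "y \<le> h"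
  shows "\<bar>F (x + y) - (\<Sum>k<n. F (x + h / 2 * (1 + chebyshev_node n k)) *
            poly (lagrange_basis (chebyshev_node n) n k) (2 * y / h - 1))\<bar>
         \<le> (\<Omega> * h / 4) ^ n / fact n * enn2real (total_variation borel \<mu>) / pi"
proof -
  define B where "B = 2 * ((\<Omega> * h / 4) ^ n / fact n)"
  have "\<bar>cos (\<omega> * (x + y)) - (\<Sum>k<n. cos (\<omega> * (x + h / 2 * (1 + chebyshev_node n k))) *
            poly (lagrange_basis (chebyshev_node n) n k) (2 * y / h - 1))\<bar> \<le> B"
    if \<omega>: "\<bar>\<omega>\<bar> \<le> \<Omega>" for \<omega>
  proof -
    define a where "a = \<omega> * h / 2"
    define b where "b = \<omega> * (x + h / 2)"
    have "\<bar>2 * y / h - 1\<bar> \<le> 1" using y h by (simp add: abs_le_iff field_simps)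
    moreover have "\<omega> * (x + y) = a * (2 * y / h - 1) + b"
      using h by (simp add: a_def b_def field_simps)
    moreover have "\<omega> * (x + h / 2 * (1 + t)) = a * t + b" for t
      by (simp add: a_def b_def field_simps)
    moreover have "\<bar>a\<bar> ^ n / (fact n * 2 ^ (n - 1)) \<le> B"
    proof -
      have "\<bar>a\<bar> \<le> \<Omega> * h / 2" using \<omega> h by (simp add: a_def abs_mult)
      then have "\<bar>a\<bar> ^ n / (fact n * 2 ^ (n - 1)) \<le> (\<Omega> * h / 2) ^ n / (fact n * 2 ^ (n - 1))"
        by (intro divide_right_mono power_mono) auto
      also have "\<dots> = B"
      proof -
        have "(2::real) ^ n = 2 * 2 ^ (n - 1)" using n by (cases n) auto
        moreover have "(4::real) ^ n = 2 ^ n * 2 ^ n" by (simp flip: power_mult_distrib)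
        ultimately show ?thesis by (simp add: B_def power_divide)
      qed
      finally show ?thesis .
    qed
    ultimately show ?thesis
      using chebyshev_interpolation_cos[OF n, of "2 * y / h - 1" a b] by simp
  qed
  from bandlimited_linear_combination_bound[OF F this] show ?thesis
    by (simp add: B_def)
qed

section \<open>Approximate ranks of unfoldings\<close>

text \<open>The constant works because \<open>n! \<ge> (n / e)\<^sup>n\<close> and \<open>e / 4 \<le> 3/4 \<le> exp (- 1/4)\<close>.\<close>

lemma power_div_fact_le_exp_minus:
  assumes "0 \<le> a" "a \<le> real n"
  shows "(a / 4) ^ n / fact n \<le> exp (- real n / 4)"
proof -
  have "real n ^ n / fact n \<le> exp (real n)"
  proof -
    have "(\<lambda>k. real n ^ k / fact k) sums exp (real n)"
      using exp_converges[of "real n"] by (simp add: divide_inverse mult.commute)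
    then show ?thesis
      using sum_le_suminf[of "\<lambda>k. real n ^ k / fact k" "{n}"] by (simp add: sums_iff)
  qed
  also have "exp (real n) = exp 1 ^ n" by (simp flip: exp_of_nat_mult)
  also have "\<dots> \<le> 3 ^ n" by (intro power_mono exp_le) auto
  finally have *: "real n ^ n / fact n \<le> 3 ^ n" .
  have "(a / 4) ^ n / fact n \<le> (real n / 4) ^ n / fact n"
    using assms by (intro divide_right_mono power_mono) auto
  also have "\<dots> = real n ^ n / fact n / 4 ^ n" by (simp add: power_divide)
  also have "\<dots> \<le> (3 / 4) ^ n" using divide_right_mono[OF *, of "4 ^ n"] by (simp add: power_divide)
  also have "\<dots> \<le> exp (- 1 / 4) ^ n"
    using exp_ge_add_one_self[of "- 1 / 4"] by (intro power_mono) auto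
  also have "\<dots> = exp (- real n / 4)" by (simp flip: exp_of_nat_mult)
  finally show ?thesis .
qed

lemma log_plus_nonneg: "0 \<le> log_plus v"
  by (simp add: log_plus_def)

lemma le_exp_log_plus:
  assumes "0 \<le> v"
  shows "v \<le> exp (log_plus v)"
proof (cases "v = 0")
  case False
  then have "v = exp (ln v)" using assms by simp
  also have "\<dots> \<le> exp (log_plus v)" using False by (simp add: log_plus_def)
  finally show ?thesis .
qed simp

lemma eps_rank_le:
  assumes "\<And>\<sigma>. length \<sigma> = K \<Longrightarrow>
      \<bar>T \<sigma> - (\<Sum>\<alpha><r. TL \<alpha> (take m \<sigma>) * TR \<alpha> (drop m \<sigma>))\<bar> \<le> \<epsilon>"
  shows "eps_rank K m \<epsilon> T \<le> r"
  unfolding eps_rank_def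
proof (rule Least_le, rule exI[of _ TL], rule exI[of _ TR])
  let ?E = "\<lambda>\<sigma>. T \<sigma> - (\<Sum>\<alpha><r. tensor_prod m (TL \<alpha>) (TR \<alpha>) \<sigma>)"
  have "finite {\<sigma> :: bool list. length \<sigma> = K}"
    using finite_lists_length_eq[of "UNIV :: bool set" K] by simp
  then have fin: "finite ((\<lambda>\<sigma>. \<bar>?E \<sigma>\<bar>) ` {\<sigma>. length \<sigma> = K})"
    by (rule finite_imageI)
  have "replicate K False \<in> {\<sigma>. length \<sigma> = K}" by simp
  then have ne: "(\<lambda>\<sigma>. \<bar>?E \<sigma>\<bar>) ` {\<sigma>. length \<sigma> = K} \<noteq> {}" by blast
  have "\<bar>?E \<sigma>\<bar> \<le> \<epsilon>" if "length \<sigma> = K" for \<sigma>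
    using assms[OF that] by (simp add: tensor_prod_def)
  then show "tensor_norm K ?E \<le> \<epsilon>"
    unfolding tensor_norm_def Max_le_iff[OF fin ne] by blast
qed

lemma eps_rank_le_power:
  assumes "m \<le> K" "\<epsilon> \<ge> 0"
  shows "eps_rank K m \<epsilon> T \<le> 2 ^ m"
proof -
  let ?L = "{\<sigma> :: bool list. length \<sigma> = m}"
  have fin: "finite ?L" and card: "card ?L = 2 ^ m"
    using finite_lists_length_eq[of "UNIV :: bool set" m] card_lists_length_eq[of "UNIV :: bool set" m]
    by simp_all
  obtain e where e: "bij_betw e {..<2 ^ m :: nat} ?L"
    using ex_bij_betw_nat_finite[OF fin] unfolding card atLeast0LessThan by blast
  \<comment> \<open>Each of the \<open>2\<^sup>m\<close> terms reproduces one row of the unfolding.\<close>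
  show ?thesis
  proof (rule eps_rank_le[where TL = "\<lambda>\<alpha> \<rho>. of_bool (\<rho> = e \<alpha>)" and TR = "\<lambda>\<alpha> \<tau>. T (e \<alpha> @ \<tau>)"])
    fix \<sigma> :: "bool list" assume "length \<sigma> = K"
    then have mem: "take m \<sigma> \<in> ?L" using assms by simp
    have "(\<Sum>\<alpha><2 ^ m. of_bool (take m \<sigma> = e \<alpha>) * T (e \<alpha> @ drop m \<sigma>)) =
        (\<Sum>\<rho>\<in>?L. of_bool (take m \<sigma> = \<rho>) * T (\<rho> @ drop m \<sigma>))"
      by (rule sum.reindex_bij_betw[OF e, of "\<lambda>\<rho>. of_bool (take m \<sigma> = \<rho>) * T (\<rho> @ drop m \<sigma>)"])
    also have "\<dots> = (\<Sum>\<rho>\<in>?L. if take m \<sigma> = \<rho> then T (\<rho> @ drop m \<sigma>) else 0)"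
      by (intro sum.cong) auto
    also have "\<dots> = T \<sigma>"
      using fin mem by simp
    finally show "\<bar>T \<sigma> - (\<Sum>\<alpha><2 ^ m. of_bool (take m \<sigma> = e \<alpha>) * T (e \<alpha> @ drop m \<sigma>))\<bar> \<le> \<epsilon>"
      using assms by simp
  qed
qed

text \<open>The dyadic point of \<open>[0, 1)\<close> whose binary digits form the given list.\<close>

definition dyadic_point :: "bool list \<Rightarrow> real" where
  "dyadic_point \<sigma> = (\<Sum>k=1..length \<sigma>. (1/2) ^ k * of_bool (\<sigma> ! (k - 1)))"

lemma dyadic_point_bounds: "0 \<le> dyadic_point \<sigma>" "dyadic_point \<sigma> \<le> 1"
proof -
  show "0 \<le> dyadic_point \<sigma>" unfolding dyadic_point_def by (intro sum_nonneg) auto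
  have "(\<Sum>k=1..n. (1/2) ^ k) = (1::real) - (1/2) ^ n" for n
    by (induction n) (auto simp: field_simps)
  moreover have "dyadic_point \<sigma> \<le> (\<Sum>k=1..length \<sigma>. (1/2) ^ k)"
    unfolding dyadic_point_def by (intro sum_mono) auto
  ultimately show "dyadic_point \<sigma> \<le> 1" by (smt (verit) zero_le_power divide_nonneg_nonneg)
qed

lemma dyadic_point_take_drop:
  assumes "m \<le> length \<sigma>"
  shows "dyadic_point \<sigma> = dyadic_point (take m \<sigma>) + (1/2) ^ m * dyadic_point (drop m \<sigma>)"
proof -
  let ?t = "\<lambda>k. (1/2::real) ^ k * of_bool (\<sigma> ! (k - 1))"
  have "dyadic_point \<sigma> = sum ?t {1..m} + sum ?t {m + 1..m + (length \<sigma> - m)}"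
    unfolding dyadic_point_def using assms sum.ub_add_nat[of 1 m ?t "length \<sigma> - m"] by simp
  also have "sum ?t {m + 1..m + (length \<sigma> - m)} = (\<Sum>k=1..length \<sigma> - m. ?t (k + m))"
    using sum.shift_bounds_cl_nat_ivl[of ?t 1 m "length \<sigma> - m"] by (simp add: add.commute)
  also have "\<dots> = (1/2) ^ m * dyadic_point (drop m \<sigma>)"
    unfolding dyadic_point_def sum_distrib_left
  proof (rule sum.cong)
    fix k assume "k \<in> {1..length (drop m \<sigma>)}"
    then have "drop m \<sigma> ! (k - 1) = \<sigma> ! (k + m - 1)"
      using assms by (simp add: add.commute)
    then show "?t (k + m) = (1/2) ^ m * ((1/2) ^ k * of_bool (drop m \<sigma> ! (k - 1)))"
      by (simp add: power_add)
  qed (use assms in simp)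
  also have "sum ?t {1..m} = dyadic_point (take m \<sigma>)"
    unfolding dyadic_point_def using assms by (auto intro!: sum.cong)
  finally show ?thesis .
qed

lemma eps_rank_bandlimited_le:
  assumes F: "bandlimited \<Omega> \<mu> F" and f: "\<forall>x\<in>{0..1}. f x = F x"
    and pos: "\<Omega> > 0" "\<epsilon> > 0" and m: "m \<le> K"
    and n: "n > 0" "\<Omega> * (1/2) ^ m \<le> real n"
      "4 * log_plus (enn2real (total_variation borel \<mu>) / \<epsilon>) \<le> real n"
  shows "eps_rank K m \<epsilon> (quantized_tensor K f) \<le> n"
proof -
  define V where "V = enn2real (total_variation borel \<mu>)"
  define h :: real where "h = (1/2) ^ m"
  have V: "V \<ge> 0" and h: "h > 0" by (simp_all add: V_def h_def)
  have err: "(\<Omega> * h / 4) ^ n / fact n * V / pi \<le> \<epsilon>"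
  proof -
    have "V / \<epsilon> \<le> exp (real n / 4)"
      using le_exp_log_plus[of "V / \<epsilon>"] V pos n(3)
      by (auto simp: V_def intro: order_trans)
    then have V_le: "V \<le> exp (real n / 4) * \<epsilon>" using pos by (simp add: field_simps)
    have "(\<Omega> * h / 4) ^ n / fact n * V \<le> exp (- real n / 4) * (exp (real n / 4) * \<epsilon>)"
      using pos h n V V_le by (intro mult_mono power_div_fact_le_exp_minus) (auto simp: h_def)
    also have "\<dots> = \<epsilon>" by (simp add: mult.assoc[symmetric] flip: exp_add)
    also have "\<epsilon> \<le> \<epsilon> * pi" using pos pi_gt3 by simp
    finally show ?thesis using pos_divide_le_eq[OF pi_gt_zero] by blast
  qed
  show ?thesis
  proof (rule eps_rank_le[where
        TL = "\<lambda>k \<rho>. F (dyadic_point \<rho> + h / 2 * (1 + chebyshev_node n k))" and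
        TR = "\<lambda>k \<tau>. poly (lagrange_basis (chebyshev_node n) n k) (2 * (h * dyadic_point \<tau>) / h - 1)"])
    fix \<sigma> :: "bool list" assume len: "length \<sigma> = K"
    let ?x = "dyadic_point (take m \<sigma>)" and ?y = "h * dyadic_point (drop m \<sigma>)"
    have "quantized_tensor K f \<sigma> = f (dyadic_point \<sigma>)"
      using len by (simp add: quantized_tensor_def dyadic_point_def)
    also have "\<dots> = F (?x + ?y)"
      using f dyadic_point_bounds[of \<sigma>] dyadic_point_take_drop[of m \<sigma>] m len by (simp add: h_def)
    finally have "quantized_tensor K f \<sigma> = F (?x + ?y)" .
    moreover have "0 \<le> ?y" "?y \<le> h"
      using dyadic_point_bounds[of "drop m \<sigma>"] h by (auto simp: mult_left_le)
    ultimately show "\<bar>quantized_tensor K f \<sigma> - (\<Sum>k<n. F (?x + h / 2 * (1 + chebyshev_node n k)) *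
        poly (lagrange_basis (chebyshev_node n) n k) (2 * ?y / h - 1))\<bar> \<le> \<epsilon>"
      using bandlimited_chebyshev_interpolation[OF F n(1) h, of ?y ?x] err unfolding V_def by simp
  qed
qed

theorem corollary10:
  shows "\<exists>C :: real. \<forall>(\<Omega> :: real) (\<mu> :: real set \<Rightarrow> real) (F :: real \<Rightarrow> real) (f :: real \<Rightarrow> real)
           (K :: nat) (\<epsilon> :: real).
     \<Omega> > 0 \<longrightarrow> bandlimited \<Omega> \<mu> F \<longrightarrow> (\<forall>x \<in> {0..1}. f x = F x) \<longrightarrow> K > 0 \<longrightarrow> \<epsilon> > 0 \<longrightarrow>
     (\<forall>m \<in> {1..K - 1}.
        real (eps_rank K m \<epsilon> (quantized_tensor K f))
          \<le> sqrt \<Omega> + C * (1 + log_plus (enn2real (total_variation borel \<mu>) / \<epsilon>)))"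
proof (rule exI[of _ 4], intro allI impI ballI)
  fix \<Omega> \<epsilon> :: real and \<mu> :: "real set \<Rightarrow> real" and F f :: "real \<Rightarrow> real" and K m :: nat
  assume \<Omega>: "\<Omega> > 0" and F: "bandlimited \<Omega> \<mu> F" and f: "\<forall>x\<in>{0..1}. f x = F x"
    and "K > 0" and \<epsilon>: "\<epsilon> > 0" and "m \<in> {1..K - 1}"
  then have m: "m \<le> K" by auto
  define L where "L = log_plus (enn2real (total_variation borel \<mu>) / \<epsilon>)"
  have L: "L \<ge> 0" unfolding L_def by (rule log_plus_nonneg)
  have "real (eps_rank K m \<epsilon> (quantized_tensor K f)) \<le> sqrt \<Omega> + 4 * (1 + L)"
  proof (cases "2 ^ m \<le> sqrt \<Omega>")
    case True
    have "real (eps_rank K m \<epsilon> (quantized_tensor K f)) \<le> real (2 ^ m)"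
      using \<epsilon> by (intro of_nat_mono eps_rank_le_power[OF m]) simp
    also have "\<dots> \<le> sqrt \<Omega>" using True by simp
    finally show ?thesis using L by simp
  next
    case False
    have "\<Omega> * (1/2) ^ m = \<Omega> / 2 ^ m" by (simp add: power_one_over)
    also have "\<dots> \<le> \<Omega> / sqrt \<Omega>" using False \<Omega> by (intro divide_left_mono) auto
    also have "\<dots> = sqrt \<Omega>" using \<Omega> by (simp add: real_div_sqrt)
    finally have le: "\<Omega> * (1/2) ^ m \<le> sqrt \<Omega>" .
    define n where "n = nat \<lceil>sqrt \<Omega> + 4 * L\<rceil>"
    have "sqrt \<Omega> > 0" using \<Omega> by simp
    then have sum_pos: "sqrt \<Omega> + 4 * L > 0" using L by linarith
    have n: "n > 0" "sqrt \<Omega> + 4 * L \<le> real n" "real n \<le> sqrt \<Omega> + 4 * L + 1"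
      unfolding n_def using sum_pos of_nat_ceiling[of "sqrt \<Omega> + 4 * L"]
        of_int_ceiling_le_add_one[of "sqrt \<Omega> + 4 * L"] by (simp_all add: of_nat_nat)
    have "eps_rank K m \<epsilon> (quantized_tensor K f) \<le> n"
    proof (rule eps_rank_bandlimited_le[OF F f \<Omega> \<epsilon> m n(1)])
      show "\<Omega> * (1/2) ^ m \<le> real n" using n(2) L le by linarith
      show "4 * log_plus (enn2real (total_variation borel \<mu>) / \<epsilon>) \<le> real n"
        using n(2) \<open>sqrt \<Omega> > 0\<close> unfolding L_def by linarith
    qed
    then have "real (eps_rank K m \<epsilon> (quantized_tensor K f)) \<le> real n"
      by (rule of_nat_mono)
    also have "\<dots> \<le> sqrt \<Omega> + 4 * L + 1" by (rule n(3))
    finally show ?thesis by simp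
  qed
  then show "real (eps_rank K m \<epsilon> (quantized_tensor K f))
      \<le> sqrt \<Omega> + 4 * (1 + log_plus (enn2real (total_variation borel \<mu>) / \<epsilon>))"
    by (simp add: L_def)
qed

end
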